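(* There exists an infinite word $V\in\{0,1\}^{\mathbb{N}}$ of unbounded spacer rank, i.e. $V$ has a spacer rank construction but does not have a spacer rank-$n$ construction for any $n\ge 1$.
   Context: Conventions: $\mathbb{N}$ is the set of nonnegative integers. A finite word is an element of $\bigcup_{m\ge 1}\{0,1\}^m$; an infinite word is an element of $\{0,1\}^{\mathbb{N}}$. Juxtaposition is concatenation and $1^a$ is $a$ consecutive $1$s. Building: let $\mathcal{F}$ be the set of all finite words that start and end with $0$, and let $S\subset\mathcal{F}$ be finite. A finite word $w$ is built from $S$ if $w=v_11^{a_1}v_21^{a_2}\cdots v_k1^{a_k}v_{k+1}$ for some $k\ge 1$, $v_i\in S$, $a_i\in\mathbb{N}$; it is built from $S$ starting with $u$ if moreover one can take $v_1=u$. An infinite word $V$ has a spacer rank construction if there are a sequence $(n_i)_{i\ge0}$ of positive integers (not required to be bounded) and finite sets $S_i=\{v_{i,1},\dots,v_{i,n_i}\}\subset\mathcal{F}$ ($i\in\mathbb{N}$) such that: $v_{0,j}=0$ for all $1\le j\le n_0$; $v_{i+1,1}$ is built from $S_i$ starting with $v_{i,1}$; $v_{i+1,j}$ is built from $S_i$ for all $2\le j\le n_{i+1}$; and $v_{i,1}$ is an initial segment of $V$ for all $i\in\mathbb{N}$. $V$ has an at most spacer rank-$n$ construction if there is such a construction with $n_i\le n$ for all $i$. For $n>1$, $V$ has a spacer rank-$n$ construction if it has an at most spacer rank-$n$ construction and does not have an at most spacer rank-$(n-1)$ construction; a spacer rank-$1$ construction is an at most spacer rank-$1$ construction. *)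

theory Defs
  imports Main
begin

datatype letter = Zero | One

type_synonym word = "letter list"
type_synonym infinite_word = "nat \<Rightarrow> letter"

definition zero_ended :: "word set" where
  "zero_ended = {w. w \<noteq> [] \<and> hd w = Zero \<and> last w = Zero}"

definition initial_segment :: "word \<Rightarrow> infinite_word \<Rightarrow> bool" where
  "initial_segment w V \<longleftrightarrow> w = map V [0..<length w]"

text \<open>The word \<open>v\<^sub>1 1\<^bsup>a\<^sub>1\<^esup> v\<^sub>2 1\<^bsup>a\<^sub>2\<^esup> \<dots> v\<^sub>k 1\<^bsup>a\<^sub>k\<^esup> v\<^sub>k\<^sub>+\<^sub>1\<close>;
  note that the list \<open>[1..<k + 1]\<close> ends with \<open>k\<close>.\<close>

definition spaced_concat :: "nat \<Rightarrow> (nat \<Rightarrow> word) \<Rightarrow> (nat \<Rightarrow> nat) \<Rightarrow> word" where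
  "spaced_concat k v a =
     concat (map (\<lambda>i. v i @ replicate (a i) One) [1..<k + 1]) @ v (k + 1)"

definition built_from :: "word set \<Rightarrow> word \<Rightarrow> bool" where
  "built_from S w \<longleftrightarrow>
     (\<exists>k v a. k \<ge> 1 \<and> (\<forall>i\<in>{1..k + 1}. v i \<in> S) \<and> w = spaced_concat k v a)"

definition built_from_starting_with :: "word set \<Rightarrow> word \<Rightarrow> word \<Rightarrow> bool" where
  "built_from_starting_with S u w \<longleftrightarrow>
     (\<exists>k v a. k \<ge> 1 \<and> (\<forall>i\<in>{1..k + 1}. v i \<in> S) \<and> v 1 = u \<and> w = spaced_concat k v a)"

text \<open>The set \<open>S\<^sub>i\<close> is \<open>v i ` {1..n i}\<close>. The enumeration may have repetitions, as it does at level
  \<open>0\<close> when \<open>n 0 > 1\<close>. Values \<open>v i j\<close> with \<open>j\<close> outside \<open>{1..n i}\<close> are irrelevant.\<close>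

definition spacer_construction ::
  "infinite_word \<Rightarrow> (nat \<Rightarrow> nat) \<Rightarrow> (nat \<Rightarrow> nat \<Rightarrow> word) \<Rightarrow> bool" where
  "spacer_construction V n v \<longleftrightarrow>
     (\<forall>i. n i > 0) \<and>
     (\<forall>i. v i ` {1..n i} \<subseteq> zero_ended) \<and>
     (\<forall>j\<in>{1..n 0}. v 0 j = [Zero]) \<and>
     (\<forall>i. built_from_starting_with (v i ` {1..n i}) (v i 1) (v (i + 1) 1)) \<and>
     (\<forall>i. \<forall>j\<in>{2..n (i + 1)}. built_from (v i ` {1..n i}) (v (i + 1) j)) \<and>
     (\<forall>i. initial_segment (v i 1) V)"

definition has_spacer_rank_construction :: "infinite_word \<Rightarrow> bool" where
  "has_spacer_rank_construction V \<longleftrightarrow> (\<exists>n v. spacer_construction V n v)"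

definition has_at_most_spacer_rank_construction :: "nat \<Rightarrow> infinite_word \<Rightarrow> bool" where
  "has_at_most_spacer_rank_construction r V \<longleftrightarrow>
     (\<exists>n v. spacer_construction V n v \<and> (\<forall>i. n i \<le> r))"

text \<open>Only meaningful for \<open>r \<ge> 1\<close>.\<close>

definition has_spacer_rank_n_construction :: "nat \<Rightarrow> infinite_word \<Rightarrow> bool" where
  "has_spacer_rank_n_construction r V \<longleftrightarrow>
     has_at_most_spacer_rank_construction r V \<and>
     (r > 1 \<longrightarrow> \<not> has_at_most_spacer_rank_construction (r - 1) V)"

definition unbounded_spacer_rank :: "infinite_word \<Rightarrow> bool" where
  "unbounded_spacer_rank V \<longleftrightarrow>
     has_spacer_rank_construction V \<and> (\<forall>r\<ge>1. \<not> has_spacer_rank_n_construction r V)"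

end

(* Interleave zeros with a binary sequence x that contains every finite word: V = 0 x_0 0 0 x_1 0 ...
   The words 0 b_1 0 ... 0 b_k 0 with k = 2^j bits are concatenations, without spacers, of such words
   with 2^(j-1) bits, so V has a spacer rank construction.  But V has at least 2^N factors of length
   3N, i.e. positive entropy.  If the i-th level of a construction has at most r words s then, as V
   has no factor 11, V is a concatenation of the at most 2r words s, s1.  All these are of length at
   least i, so V has at most C (2r)^K factors of length l whenever l + C <= K i, with C the maximal
   length of the pieces: the entropy is at most log (2r) / i, which tends to 0 if r is fixed. *)
theory Submission
  imports Defs "HOL-Library.Countable" "HOL-Library.Discrete_Functions"
begin

section \<open>A binary sequence containing every finite word\<close>

lemma ex_disjunctive_sequence:
  "\<exists>x :: nat \<Rightarrow> 'a::countable. \<forall>w. \<exists>p. w = map x [p..<p + length w]"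
proof -
  \<comment> \<open>On the positions from \<open>c\<^sup>2\<close> to
    \<open>(c + 1)\<^sup>2 - 1\<close>, \<open>x\<close> spells the word coded by the second
    component of \<open>c\<close>; past the end of that word its value is unspecified.\<close>
  define x :: "nat \<Rightarrow> 'a" where
    "x n = from_nat (snd (prod_decode (floor_sqrt n))) ! (n - (floor_sqrt n)\<^sup>2)" for n
  have "\<exists>p. w = map x [p..<p + length w]" for w
  proof
    \<comment> \<open>Pairing with the length forces \<open>length w \<le> c\<close>, so that
      \<open>w\<close> fits into the \<open>2 * c + 1\<close> positions of block
      \<open>c\<close>.\<close>
    define c where "c = prod_encode (length w, to_nat w)"
    have len: "length w \<le> c"
      unfolding c_def by (rule le_prod_encode_1)
    have "x (c\<^sup>2 + k) = w ! k" if "k < length w" for k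
    proof -
      have "floor_sqrt (c\<^sup>2 + k) = c"
        using that len by (intro floor_sqrt_unique) (auto simp: power2_eq_square)
      then show ?thesis
        by (simp add: x_def c_def)
    qed
    then show "w = map x [c\<^sup>2..<c\<^sup>2 + length w]"
      by (intro nth_equalityI) auto
  qed
  then show ?thesis by blast
qed

section \<open>Interleaving bits with zeros\<close>

definition encode :: "bool list \<Rightarrow> word" where
  "encode w = concat (map (\<lambda>b. [Zero, if b then One else Zero, Zero]) w)"

definition encode_infinite :: "(nat \<Rightarrow> bool) \<Rightarrow> infinite_word" where
  "encode_infinite x n = (if n mod 3 = 1 \<and> x (n div 3) then One else Zero)"

lemma encode_simps [simp]:
  "encode [] = []"
  "encode (b # w) = Zero # (if b then One else Zero) # Zero # encode w"
  "encode (u @ w) = encode u @ encode w"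
  by (simp_all add: encode_def)

lemma length_encode [simp]: "length (encode w) = 3 * length w"
  by (induction w) auto

lemma inj_encode: "inj encode"
proof
  show "u = w" if "encode u = encode w" for u w
    using that
  proof (induction u arbitrary: w)
    case Nil
    then show ?case by (cases w) auto
  next
    case (Cons b u)
    then show ?case by (cases w) (auto split: if_splits)
  qed
qed

lemma encode_zero_ended:
  assumes "w \<noteq> []"
  shows "encode w \<in> zero_ended"
proof -
  have "hd (encode w) = Zero"
    using assms by (cases w) auto
  moreover have "last (encode w) = Zero"
    using assms by (cases w rule: rev_cases) auto
  moreover have "encode w \<noteq> []"
    using assms by (cases w) auto
  ultimately show ?thesis
    by (auto simp: zero_ended_def)
qed

text \<open>Links finite and infinite encodings: with \<open>p = 0\<close> it yields the initial
  segments of the construction, with arbitrary \<open>p\<close> it finds every encoded word as a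
  factor.\<close>

lemma encode_map_upt:
  "encode (map x [p..<p + k]) = map (encode_infinite x) [3 * p..<3 * (p + k)]"
proof (induction k)
  case (Suc k)
  define q where "q = 3 * (p + k)"
  have "[3 * p..<3 * (p + Suc k)] = [3 * p..<q] @ [q, q + 1, q + 2]"
    by (simp add: q_def numeral_3_eq_3)
  moreover have "encode_infinite x q = Zero" "encode_infinite x (q + 2) = Zero"
      "encode_infinite x (q + 1) = (if x (p + k) then One else Zero)"
    by (simp_all add: encode_infinite_def q_def mod_Suc div_Suc)
  moreover have "encode (map x [p..<p + k]) = map (encode_infinite x) [3 * p..<q]"
    using Suc unfolding q_def .
  ultimately show ?case
    by simp
qed simp

text \<open>Ones occur only at positions congruent to 1 modulo 3. This will limit every run of
  spacers to length at most one.\<close>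

lemma encode_infinite_no_consecutive_ones:
  "\<not> (encode_infinite x n = One \<and> encode_infinite x (n + 1) = One)"
proof -
  have "\<not> (n mod 3 = 1 \<and> (n + 1) mod 3 = 1)"
    by presburger
  then show ?thesis
    unfolding encode_infinite_def by (metis letter.distinct(1))
qed

section \<open>Existence of a spacer rank construction\<close>

lemma built_from_append:
  assumes "u \<in> S" "w \<in> S"
  shows "built_from_starting_with S u (u @ replicate a One @ w)"
  unfolding built_from_starting_with_def
  using assms
  by (intro exI[of _ 1] exI[of _ "\<lambda>i. if i = 1 then u else w"] exI[of _ "\<lambda>_. a"])
     (auto simp: spaced_concat_def)

lemma built_from_starting_with_imp: "built_from_starting_with S u w \<Longrightarrow> built_from S w"
  by (auto simp: built_from_starting_with_def built_from_def)

text \<open>Prepending \<open>u\<close> to a listing of \<open>S\<close> repeats \<open>u\<close>,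
  which enumerations of the levels may do.\<close>

lemma ex_enumeration_with_first:
  assumes "finite S" "u \<in> S"
  shows "\<exists>n f. n > 0 \<and> f 1 = u \<and> f ` {1..n::nat} = S"
proof -
  obtain xs where xs: "set xs = S"
    using finite_list[OF assms(1)] by blast
  define f where "f j = (u # xs) ! (j - 1)" for j
  have "f ` {1..length (u # xs)} = f ` Suc ` {..<length (u # xs)}"
    by (simp add: image_Suc_lessThan)
  also have "\<dots> = (!) (u # xs) ` {..<length (u # xs)}"
    by (simp add: image_image f_def)
  also have "\<dots> = set (u # xs)"
    by (metis atLeast_upt set_map map_nth)
  finally have "f ` {1..length (u # xs)} = S"
    using xs assms(2) by auto
  moreover have "f 1 = u" by (simp add: f_def)
  ultimately show ?thesis by blast
qed

lemma has_spacer_rank_constructionI: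
  fixes S :: "nat \<Rightarrow> word set"
  assumes fin: "\<And>i. finite (S i)" and u: "\<And>i. u i \<in> S i"
    and S0: "S 0 = {[Zero]}" and zero: "\<And>i. S i \<subseteq> zero_ended"
    and start: "\<And>i. built_from_starting_with (S i) (u i) (u (i + 1))"
    and built: "\<And>i w. w \<in> S (i + 1) \<Longrightarrow> built_from (S i) w"
    and prefix: "\<And>i. initial_segment (u i) V"
  shows "has_spacer_rank_construction V"
proof -
  have "\<forall>i. \<exists>n f. n > 0 \<and> f (1::nat) = u i \<and> f ` {1..n::nat} = S i"
    using ex_enumeration_with_first[OF fin u] by blast
  then obtain n f where nf: "\<And>i. n i > 0" "\<And>i. f i (1::nat) = u i" "\<And>i. f i ` {1..n i} = S i"
    by metis
  have mem: "f i j \<in> S i" if "j \<in> {1..n i}" for i j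
    using nf(3)[of i] that by blast
  have "spacer_construction V n f"
    unfolding spacer_construction_def nf
    using nf(1) zero start prefix mem[of _ 0] S0 by (auto intro!: built mem)
  then show ?thesis
    unfolding has_spacer_rank_construction_def by blast
qed

lemma encode_infinite_has_spacer_rank_construction:
  "has_spacer_rank_construction (encode_infinite x)"
proof -
  \<comment> \<open>The prescribed level 0 is just \<open>[Zero]\<close>; level \<open>k + 1\<close>
    consists of all encodings of \<open>2 ^ k\<close> bits, whose number grows without
    bound.\<close>
  define B :: "nat \<Rightarrow> word set" where "B k = encode ` {w. length w = 2 ^ k}" for k
  define b where "b k = encode (map x [0..<2 ^ k])" for k
  define S where "S = case_nat {[Zero]} B"
  define u where "u = case_nat [Zero] b"
  have bB: "b k \<in> B k" for k
    by (auto simp: b_def B_def)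
  have BI: "built_from_starting_with (B k) (encode v) (encode (v @ w))"
    if "length v = 2 ^ k" "length w = 2 ^ k" for k v w
    using built_from_append[of "encode v" "B k" "encode w" 0] that by (auto simp: B_def)
  \<comment> \<open>The two blocks are \<open>0 1 0\<close>, two zeros around one spacer, and
    \<open>0 0 0\<close>, three zeros without spacers.\<close>
  have B0: "built_from_starting_with {[Zero]} [Zero] (encode [c])" for c
  proof (cases c)
    case True
    then show ?thesis
      using built_from_append[of "[Zero]" "{[Zero]}" "[Zero]" 1] by simp
  next
    case False
    then show ?thesis
      unfolding built_from_starting_with_def
      by (intro exI[of _ 2] exI[of _ "\<lambda>_. [Zero]"] exI[of _ "\<lambda>_. 0"])
         (simp add: spaced_concat_def upt_rec)
  qed
  show ?thesis
  proof (rule has_spacer_rank_constructionI[of S u])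
    fix i
    show "finite (S i)"
      using finite_lists_length_eq[of "UNIV :: bool set"] by (auto simp: S_def B_def split: nat.splits)
    show "u i \<in> S i"
      using bB by (auto simp: u_def S_def split: nat.splits)
    show "S 0 = {[Zero]}"
      by (simp add: S_def)
    show "S i \<subseteq> zero_ended"
    proof (cases i)
      case 0
      then show ?thesis by (simp add: S_def zero_ended_def)
    next
      case (Suc k)
      have "encode w \<in> zero_ended" if "length w = 2 ^ k" for w
        using that by (intro encode_zero_ended) auto
      then show ?thesis by (auto simp: S_def B_def Suc)
    qed
    show "built_from_starting_with (S i) (u i) (u (i + 1))"
    proof (cases i)
      case 0
      then show ?thesis
        using B0[of "x 0"] by (simp add: S_def u_def b_def)
    next
      case (Suc k)
      have "[0..<2 ^ (k + 1)] = [0..<2 ^ k] @ [2 ^ k..<2 ^ k + 2 ^ k :: nat]"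
        using upt_add_eq_append[of 0 "2 ^ k" "2 ^ k"] by (simp add: mult_2)
      then have "b (k + 1) = encode (map x [0..<2 ^ k] @ map x [2 ^ k..<2 ^ k + 2 ^ k])"
        by (simp only: b_def map_append)
      then show ?thesis
        using BI[of "map x [0..<2 ^ k]" k "map x [2 ^ k..<2 ^ k + 2 ^ k]"]
        by (simp add: S_def u_def Suc b_def[of k])
    qed
    show "built_from (S i) w" if w: "w \<in> S (i + 1)" for w
    proof (cases i)
      case 0
      obtain y where "w = encode y" "length y = 1"
        using w by (auto simp: S_def B_def 0)
      then obtain c where "w = encode [c]"
        by (cases y) auto
      then show ?thesis
        using built_from_starting_with_imp[OF B0[of c]] by (simp add: S_def 0)
    next
      case (Suc k)
      obtain y where y: "w = encode y" "length y = 2 ^ (k + 1)"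
        using w by (auto simp: S_def B_def Suc)
      then have "built_from (B k) (encode (take (2 ^ k) y @ drop (2 ^ k) y))"
        by (intro built_from_starting_with_imp[OF BI]) auto
      then show ?thesis
        using y by (simp add: S_def Suc del: encode_simps)
    qed
    show "initial_segment (u i) (encode_infinite x)"
    proof (cases i)
      case 0
      then show ?thesis
        by (simp add: u_def initial_segment_def encode_infinite_def)
    next
      case (Suc k)
      then show ?thesis
        using encode_map_upt[of x 0 "2 ^ k"] by (simp add: u_def b_def initial_segment_def)
    qed
  qed
qed

section \<open>Parsings and the number of factors\<close>

lemma concat_position:
  assumes "p < length (concat ps)"
  shows "\<exists>qs r rs k. ps = qs @ r # rs \<and> p = length (concat qs) + k \<and> k < length r"
  using assms
proof (induction ps arbitrary: p)
  case (Cons q ps)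
  show ?case
  proof (cases "p < length q")
    case True
    then have "q # ps = [] @ q # ps \<and> p = length (concat []) + p \<and> p < length q" by simp
    then show ?thesis by blast
  next
    case False
    then have "p - length q < length (concat ps)"
      using Cons.prems by auto
    from Cons.IH[OF this] obtain qs r rs k where
      "ps = qs @ r # rs" "p - length q = length (concat qs) + k" "k < length r" by blast
    then have "q # ps = (q # qs) @ r # rs \<and> p = length (concat (q # qs)) + k \<and> k < length r"
      using False by auto
    then show ?thesis by blast
  qed
qed simp

lemma length_concat_le:
  "(\<And>p. p \<in> set ps \<Longrightarrow> length p \<le> C) \<Longrightarrow> length (concat ps) \<le> length ps * C"
  by (induction ps) (auto intro: add_mono)

lemma length_concat_ge:
  "(\<And>p. p \<in> set ps \<Longrightarrow> L \<le> length p) \<Longrightarrow> length ps * L \<le> length (concat ps)"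
  by (induction ps) (auto intro: add_mono)

text \<open>A finitary form of being an infinite concatenation of words of \<open>P\<close>:
  parsings of different prefixes are chosen independently.\<close>

definition parsable :: "word set \<Rightarrow> infinite_word \<Rightarrow> bool" where
  "parsable P V \<longleftrightarrow>
     (\<forall>n. \<exists>ps\<in>lists P. n \<le> length (concat ps) \<and> initial_segment (concat ps) V)"

text \<open>The factor starts at an offset \<open>k < C\<close> inside some piece. The
  \<open>K\<close> pieces from there on have at least \<open>K * L \<ge> l + C\<close> letters, so
  they cover it.\<close>

lemma parsable_factor:
  assumes V: "parsable P V"
    and C: "\<And>p. p \<in> P \<Longrightarrow> length p \<le> C" and L: "\<And>p. p \<in> P \<Longrightarrow> L \<le> length p"
    and K: "l + C \<le> K * L"
  shows "\<exists>k<C. \<exists>rs. set rs \<subseteq> P \<and> length rs = K \<and> map V [p..<p + l] = take l (drop k (concat rs))"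
proof -
  \<comment> \<open>More than \<open>K * C\<close> letters remain from the piece containing position
    \<open>p\<close> onwards, hence more than \<open>K\<close> pieces of length at most
    \<open>C\<close>.\<close>
  obtain ps where ps: "ps \<in> lists P" "p + K * C + l + 1 \<le> length (concat ps)"
      "initial_segment (concat ps) V"
    using V unfolding parsable_def by meson
  then obtain qs r rs k where
    split: "ps = qs @ r # rs" "p = length (concat qs) + k" "k < length r"
    using concat_position[of p ps] by auto
  define ts where "ts = r # rs"
  have ts: "set ts \<subseteq> P"
    using ps(1) split(1) by (auto simp: ts_def)
  have kC: "k < C"
    using split(3) C[of r] ts by (auto simp: ts_def)
  have "K * C < length (concat ts)"
    using ps(2) split by (simp add: ts_def)
  also have "\<dots> \<le> length ts * C"
    using ts C by (intro length_concat_le) auto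
  finally have Kts: "K < length ts" by simp
  have tsK: "set (take K ts) \<subseteq> P"
    using ts set_take_subset by fast
  have "K * L \<le> length (concat (take K ts))"
    using length_concat_ge[of "take K ts" L] tsK L Kts by auto
  then have long: "k + l \<le> length (concat (take K ts))"
    using K kC by simp
  have "concat ts = concat (take K ts) @ concat (drop K ts)"
    by (metis append_take_drop_id concat_append)
  then have "take l (drop k (concat (take K ts))) = take l (drop k (concat ts))"
    using long by simp
  also have "\<dots> = take l (drop p (concat ps))"
    using split by (simp add: ts_def)
  also have "\<dots> = take l (drop p (map V [0..<length (concat ps)]))"
    using ps(3) unfolding initial_segment_def by metis
  also have "\<dots> = map V [p..<p + l]"
    using ps(2) by (simp add: take_map drop_map)
  finally show ?thesis
    using kC tsK Kts by (metis length_take min.absorb2 less_imp_le)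
qed

text \<open>An offset below \<open>C\<close> and a list of \<open>K\<close> pieces determine the
  factor. Finiteness is recorded too, since \<open>card\<close> is 0 on infinite sets.\<close>

lemma card_parsable_factors_le:
  assumes V: "parsable P V" and fin: "finite P"
    and C: "\<And>p. p \<in> P \<Longrightarrow> length p \<le> C" and L: "\<And>p. p \<in> P \<Longrightarrow> L \<le> length p"
    and K: "l + C \<le> K * L"
  shows "finite (range (\<lambda>p. map V [p..<p + l]))"
    and "card (range (\<lambda>p. map V [p..<p + l])) \<le> C * card P ^ K"
proof -
  define D where "D = {..<C} \<times> {rs. set rs \<subseteq> P \<and> length rs = K}"
  have D: "finite D" "card D = C * card P ^ K"
    using fin by (simp_all add: D_def finite_lists_length_eq card_cartesian_product card_lists_length_eq)
  have sub: "range (\<lambda>p. map V [p..<p + l]) \<subseteq> (\<lambda>(k, rs). take l (drop k (concat rs))) ` D"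
    using parsable_factor[OF V C L K] by (force simp: D_def)
  show "finite (range (\<lambda>p. map V [p..<p + l]))"
    using finite_subset[OF sub] D(1) by simp
  show "card (range (\<lambda>p. map V [p..<p + l])) \<le> C * card P ^ K"
    using surj_card_le[OF D(1) sub] D(2) by simp
qed

text \<open>All \<open>2 ^ N\<close> encodings of \<open>N\<close> bits are factors of length
  \<open>3 * N\<close>, more than pieces this long and this few can produce.\<close>

lemma disjunctive_encode_not_parsable:
  assumes x: "\<And>w. \<exists>p. w = map x [p..<p + length w]"
    and fin: "finite P" and card: "card P \<le> 2 ^ m"
    and L: "\<And>p. p \<in> P \<Longrightarrow> 3 * (m + 1) \<le> length p"
  shows "\<not> parsable P (encode_infinite x)"
proof
  let ?V = "encode_infinite x"
  assume V: "parsable P ?V"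
  define C where "C = Max (length ` P)"
  have C: "length p \<le> C" if "p \<in> P" for p
    using fin that by (simp add: C_def)
  \<comment> \<open>With \<open>2 * C\<close> pieces there are at most
    \<open>C * 2 ^ (2 * C * m)\<close> factors. \<open>N\<close> exceeds this exponent by exactly
    \<open>C\<close>, which leads to \<open>2 ^ C \<le> C\<close>, and \<open>3 * N + C\<close> is
    still covered by the pieces.\<close>
  define N where "N = C * (2 * m + 1)"
  have K: "3 * N + C \<le> (2 * C) * (3 * (m + 1))"
    by (simp add: N_def algebra_simps)
  define F where "F = range (\<lambda>p. map ?V [p..<p + 3 * N])"
  have F: "finite F" "card F \<le> C * card P ^ (2 * C)"
    using card_parsable_factors_le[OF V fin C L K] by (simp_all add: F_def)
  have "encode ` {w. length w = N} \<subseteq> F"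
  proof clarify
    fix w :: "bool list"
    assume w: "N = length w"
    obtain p where "w = map x [p..<p + length w]"
      using x by blast
    then have "encode w = map ?V [3 * p..<3 * p + 3 * N]"
      using encode_map_upt[of x p N] w by (simp add: distrib_left)
    then show "encode w \<in> F" by (auto simp: F_def)
  qed
  then have "card {w :: bool list. length w = N} \<le> card F"
    using card_inj_on_le[OF inj_on_subset[OF inj_encode]] F(1) by blast
  moreover have "card {w :: bool list. length w = N} = 2 ^ N"
    using card_lists_length_eq[of "UNIV :: bool set" N] by simp
  moreover have "card P ^ (2 * C) \<le> (2 ^ m) ^ (2 * C)"
    using card by (rule power_mono) simp
  ultimately have "2 ^ N \<le> C * (2 ^ m) ^ (2 * C)"
    using F(2) by (metis le_trans mult_le_mono2)
  also have "(2::nat) ^ N = 2 ^ C * (2 ^ m) ^ (2 * C)"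
  proof -
    have "N = C + m * (2 * C)"
      by (simp add: N_def algebra_simps)
    then show ?thesis
      by (simp add: power_add power_mult)
  qed
  finally have "(2::nat) ^ C \<le> C" by simp
  then show False
    using less_exp[of C] by simp
qed


section \<open>From spacer constructions to parsings\<close>

abbreviation spaced_pieces :: "word set \<Rightarrow> word set" where
  "spaced_pieces S \<equiv> {s @ replicate a One |s a. s \<in> S}"

text \<open>A piece with two or more spacers would put \<open>11\<close> into \<open>V\<close>. So
  the infinitely many possible pieces reduce to \<open>s\<close> and
  \<open>s @ [One]\<close>.\<close>

lemma no_consecutive_ones_parsable:
  assumes w: "\<And>n. \<exists>ps\<in>lists (spaced_pieces S).
      n \<le> length (concat ps) \<and> initial_segment (concat ps) V"
    and V: "\<And>n. \<not> (V n = One \<and> V (n + 1) = One)"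
  shows "parsable (S \<union> (\<lambda>s. s @ [One]) ` S) V"
proof -
  have "q \<in> S \<union> (\<lambda>s. s @ [One]) ` S"
    if ps: "ps \<in> lists (spaced_pieces S)"
      and init: "initial_segment (concat ps) V" and q: "q \<in> set ps" for ps q
  proof -
    obtain s a where s: "q = s @ replicate a One" "s \<in> S"
      using ps q by auto
    obtain xs ys where split: "ps = xs @ q # ys"
      using q by (meson split_list)
    \<comment> \<open>The position in \<open>V\<close> where the spacers of \<open>q\<close>
      begin.\<close>
    define p where "p = length (concat xs) + length s"
    have nth: "V n = concat ps ! n" if "n < length (concat ps)" for n
      using init that unfolding initial_segment_def
      by (metis add_0 diff_zero length_upt nth_map nth_upt)
    have "V (p + j) = One" if "j < a" for j
      using that by (subst nth) (auto simp: split s(1) p_def nth_append)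
    then have "\<not> a \<ge> 2"
      using V[of p] by (metis One_nat_def Suc_le_lessD add.right_neutral less_2_cases_iff
          numeral_2_eq_2 less_le_trans)
    then have "a = 0 \<or> a = 1" by auto
    then show ?thesis
      using s by auto
  qed
  then show ?thesis
    unfolding parsable_def using w by (meson in_lists_conv_set)
qed

text \<open>Unlike in \<open>built_from\<close>, the last word may carry spacers too, which gives
  closure under concatenation and under appending ones. Excluding the empty list ensures a last
  piece to absorb such ones.\<close>

definition segmented :: "word set \<Rightarrow> word set" where
  "segmented S = concat ` (lists (spaced_pieces S) - {[]})"

lemma segmented_base: "s \<in> S \<Longrightarrow> s \<in> segmented S"
  unfolding segmented_def
  by (intro image_eqI[of _ _ "[s]"]) (auto intro!: exI[of _ s] exI[of _ "0 :: nat"])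

lemma segmented_append:
  assumes "u \<in> segmented S" "w \<in> segmented S"
  shows "u @ w \<in> segmented S"
proof -
  let ?Q = "spaced_pieces S"
  obtain ps qs where "ps \<in> lists ?Q - {[]}" "qs \<in> lists ?Q - {[]}" "u = concat ps" "w = concat qs"
    using assms unfolding segmented_def by blast
  then show ?thesis
    unfolding segmented_def by (intro image_eqI[of _ _ "ps @ qs"]) auto
qed

lemma segmented_append_ones:
  assumes "u \<in> segmented S"
  shows "u @ replicate b One \<in> segmented S"
proof -
  let ?Q = "spaced_pieces S"
  obtain ps q where ps: "ps \<in> lists ?Q" "q \<in> ?Q" "u = concat (ps @ [q])"
  proof -
    obtain qs where qs: "qs \<in> lists ?Q" "qs \<noteq> []" "u = concat qs"
      using assms unfolding segmented_def by blast
    then have "butlast qs @ [last qs] \<in> lists ?Q"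
      by simp
    then have "butlast qs \<in> lists ?Q" "last qs \<in> ?Q"
      by (simp_all only: append_in_lists_conv Cons_in_lists_iff)
    then show thesis
      using that[of "butlast qs" "last qs"] qs by simp
  qed
  then obtain s a where "q = s @ replicate a One" "s \<in> S" by blast
  then have "q @ replicate b One \<in> ?Q"
    by (auto simp flip: replicate_add)
  then show ?thesis
    unfolding segmented_def using ps
    by (intro image_eqI[of _ _ "ps @ [q @ replicate b One]"]) auto
qed

lemma spaced_concat_0: "spaced_concat 0 v a = v 1"
  by (simp add: spaced_concat_def)

lemma spaced_concat_Suc:
  "spaced_concat (Suc k) v a = spaced_concat k v a @ replicate (a (k + 1)) One @ v (k + 2)"
  by (simp add: spaced_concat_def)

lemma segmented_spaced_concat:
  "\<forall>i\<in>{1..k + 1}. v i \<in> segmented S \<Longrightarrow> spaced_concat k v a \<in> segmented S"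
proof (induction k)
  case (Suc k)
  then have "(spaced_concat k v a @ replicate (a (k + 1)) One) @ v (k + 2) \<in> segmented S"
    by (intro segmented_append segmented_append_ones) auto
  then show ?case
    by (simp add: spaced_concat_Suc)
qed (simp add: spaced_concat_0)

text \<open>The first word contributes \<open>L\<close> letters, each of the \<open>k\<close> others
  at least one.\<close>

lemma length_spaced_concat_ge:
  "\<forall>i\<in>{1..k + 1}. v i \<noteq> [] \<and> L \<le> length (v i) \<Longrightarrow> L + k \<le> length (spaced_concat k v a)"
proof (induction k)
  case (Suc k)
  then have "length (v (k + 2)) \<ge> 1"
    by (simp add: Suc_le_eq)
  then show ?case
    using Suc by (auto simp: spaced_concat_Suc)
qed (simp add: spaced_concat_0)

lemma spacer_construction_built_from:
  assumes "spacer_construction V n v" "j \<in> {1..n (i + 1)}"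
  shows "built_from (v i ` {1..n i}) (v (i + 1) j)"
proof (cases "j = 1")
  case True
  then show ?thesis
    using assms built_from_starting_with_imp unfolding spacer_construction_def by blast
next
  case False
  then have "j \<in> {2..n (i + 1)}"
    using assms(2) by auto
  then show ?thesis
    using assms(1) unfolding spacer_construction_def by blast
qed

text \<open>As \<open>k \<ge> 1\<close> in \<open>built_from\<close>, each level joins at least two
  nonempty words of the level below, so the minimal length grows by at least one.\<close>

lemma spacer_construction_length_ge:
  assumes sc: "spacer_construction V n v" and "j \<in> {1..n i}"
  shows "i \<le> length (v i j)"
  using assms(2)
proof (induction i arbitrary: j)
  case (Suc i)
  obtain k f a where k: "k \<ge> 1" "\<forall>l\<in>{1..k + 1}. f l \<in> v i ` {1..n i}"
      "v (i + 1) j = spaced_concat k f a"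
    using spacer_construction_built_from[OF sc, of j i] Suc.prems unfolding built_from_def by auto
  have "w \<noteq> [] \<and> i \<le> length w" if "w \<in> v i ` {1..n i}" for w
    using sc that Suc.IH unfolding spacer_construction_def zero_ended_def by blast
  then have "i + k \<le> length (v (i + 1) j)"
    unfolding k(3) using k(2) by (intro length_spaced_concat_ge) blast
  then show ?case
    using k(1) by simp
qed simp

text \<open>Unfolding \<open>d\<close> levels keeps the form of spaced pieces, so arbitrarily long
  initial segments of \<open>V\<close> are expressed through the fixed level
  \<open>i\<close>.\<close>

lemma spacer_construction_segmented:
  assumes sc: "spacer_construction V n v" and "j \<in> {1..n (i + d)}"
  shows "v (i + d) j \<in> segmented (v i ` {1..n i})"
  using assms(2)
proof (induction d arbitrary: j)
  case 0
  then show ?case by (intro segmented_base) simp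
next
  case (Suc d)
  obtain k f a where "\<forall>l\<in>{1..k + 1}. f l \<in> v (i + d) ` {1..n (i + d)}"
      "v (i + d + 1) j = spaced_concat k f a"
    using spacer_construction_built_from[OF sc, of j "i + d"] Suc.prems unfolding built_from_def by auto
  then show ?case
    using segmented_spaced_concat[of k f] Suc.IH by fastforce
qed

text \<open>For a prefix of length at least \<open>m\<close>, take the first word \<open>m\<close>
  levels above \<open>i\<close> and cut it into pieces of level \<open>i\<close>.\<close>

lemma spacer_construction_parsable:
  assumes sc: "spacer_construction V n v" and V: "\<And>n. \<not> (V n = One \<and> V (n + 1) = One)"
  shows "parsable (v i ` {1..n i} \<union> (\<lambda>s. s @ [One]) ` v i ` {1..n i}) V"
proof (rule no_consecutive_ones_parsable)
  show "\<not> (V m = One \<and> V (m + 1) = One)" for m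
    by (rule V)
  fix m
  have n: "1 \<in> {1..n (i + m)}"
    using sc unfolding spacer_construction_def by (simp add: Suc_le_eq)
  obtain ps where ps: "ps \<in> lists (spaced_pieces (v i ` {1..n i}))"
      "v (i + m) 1 = concat ps"
    using spacer_construction_segmented[OF sc n] unfolding segmented_def by blast
  have "m \<le> length (v (i + m) 1)"
    using spacer_construction_length_ge[OF sc n] by simp
  moreover have "initial_segment (v (i + m) 1) V"
    using sc unfolding spacer_construction_def by blast
  ultimately show "\<exists>ps\<in>lists (spaced_pieces (v i ` {1..n i})).
      m \<le> length (concat ps) \<and> initial_segment (concat ps) V"
    using ps by auto
qed

section \<open>Unbounded spacer rank\<close>

lemma disjunctive_encode_no_bounded_construction:
  assumes x: "\<And>w. \<exists>p. w = map x [p..<p + length w]"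
  shows "\<not> has_at_most_spacer_rank_construction r (encode_infinite x)"
proof
  assume "has_at_most_spacer_rank_construction r (encode_infinite x)"
  then obtain n v where sc: "spacer_construction (encode_infinite x) n v" and r: "\<And>i. n i \<le> r"
    unfolding has_at_most_spacer_rank_construction_def by blast
  \<comment> \<open>This is \<open>3 * (m + 1)\<close> for \<open>m = 2 * r\<close>: words of level
    \<open>i\<close> are long enough, and there are at most \<open>2 * r \<le> 2 ^ m\<close>
    pieces.\<close>
  define i where "i = 3 * (2 * r + 1)"
  define S where "S = v i ` {1..n i}"
  define P where "P = S \<union> (\<lambda>s. s @ [One]) ` S"
  have S: "finite S" "card S \<le> r"
    using card_image_le[of "{1..n i}" "v i"] r[of i] by (auto simp: S_def)
  have "card P \<le> card S + card ((\<lambda>s. s @ [One]) ` S)"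
    unfolding P_def by (rule card_Un_le)
  also have "\<dots> \<le> 2 * r"
    using card_image_le[OF S(1), of "\<lambda>s. s @ [One]"] S(2) by simp
  also have "\<dots> \<le> 2 ^ (2 * r)"
    by (simp add: less_imp_le)
  finally have card: "card P \<le> 2 ^ (2 * r)" .
  have "finite P"
    using S by (simp add: P_def)
  moreover have "3 * (2 * r + 1) \<le> length p" if "p \<in> P" for p
    using that spacer_construction_length_ge[OF sc, of _ i]
    unfolding P_def S_def i_def[symmetric] by (fastforce intro: le_SucI)
  ultimately have np: "\<not> parsable P (encode_infinite x)"
    by (rule disjunctive_encode_not_parsable[OF x _ card])
  have "parsable P (encode_infinite x)"
    unfolding P_def S_def
    by (rule spacer_construction_parsable) (fact sc encode_infinite_no_consecutive_ones)+
  then show False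
    using np by contradiction
qed

theorem proposition2p8:
  shows "\<exists>V :: infinite_word. unbounded_spacer_rank V"
proof -
  obtain x :: "nat \<Rightarrow> bool" where "\<forall>w. \<exists>p. w = map x [p..<p + length w]"
    using ex_disjunctive_sequence by blast
  \<comment> \<open>A rank-\<open>r\<close> construction is in particular one of rank at most
    \<open>r\<close>, which is excluded for every \<open>r\<close>.\<close>
  then have "unbounded_spacer_rank (encode_infinite x)"
    using encode_infinite_has_spacer_rank_construction disjunctive_encode_no_bounded_construction
    unfolding unbounded_spacer_rank_def has_spacer_rank_n_construction_def by blast
  then show ?thesis by blast
qed

end
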